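(* Let $p$ be an odd prime. The coordinator polynomial of $\mathbb{Z}[\zeta_{2p}]$ equals \[ h_{2p}(x)=\sum_{k=0}^{\frac{p-3}{2}}\left(x^k+x^{p-1-k}\right)\sum_{j=0}^{k}\binom{p}{j}+x^{\frac{p-1}{2}}\sum_{j=0}^{\frac{p-1}{2}}\binom{p}{j}. \]
   Context: Let $\zeta_{m}=e^{2\pi i/m}$ and $M$ the set of $m$-th roots of unity, which generates $\mathbb{Z}[\zeta_m]\cong\mathbb{Z}^{\phi(m)}$ as a monoid. The word length of $z\in\mathbb{Z}[\zeta_m]$ is the minimal number of elements of $M$ (repetitions allowed) whose sum is $z$; $S(n)$ is the number of elements of word length exactly $n$, and the coordinator polynomial $h_m(x)$ is the polynomial with $\sum_{n\ge0}S(n)x^n=h_m(x)/(1-x)^{\phi(m)}$. *)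

theory Defs
  imports
    Complex_Main
    "HOL-Library.Multiset"
    "HOL-Computational_Algebra.Computational_Algebra"
    "HOL-Number_Theory.Totient"
begin

definition zeta :: "nat \<Rightarrow> complex" where
  "zeta m = exp (2 * of_real pi * \<i> / of_nat m)"

definition roots_of_unity :: "nat \<Rightarrow> complex set" where
  "roots_of_unity m = {z. z ^ m = 1}"

definition cyclotomic_integers :: "nat \<Rightarrow> complex set" where
  "cyclotomic_integers m = {poly (map_poly of_int q) (zeta m) |q :: int poly. True}"

text \<open>The multiset \<open>A\<close> is the family of summands, with repetitions. For \<open>m \<ge> 2\<close>
  every element of \<^term>\<open>cyclotomic_integers m\<close> has such a representation, see
  \<open>cyclotomic_integers_generated\<close> below; zero has word length 0.\<close>

definition word_length :: "nat \<Rightarrow> complex \<Rightarrow> nat" where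
  "word_length m z =
     (LEAST n. \<exists>A. set_mset A \<subseteq> roots_of_unity m \<and> size A = n \<and> sum_mset A = z)"

text \<open>For \<open>m \<ge> 2\<close> the set counted here is finite (\<open>finite_sphere\<close>), so \<^const>\<open>card\<close>
  does not fall back to its default value.\<close>

definition growth :: "nat \<Rightarrow> nat \<Rightarrow> nat" where
  "growth m n = card {z \<in> cyclotomic_integers m. word_length m z = n}"

text \<open>The polynomial is required to satisfy the defining identity as formal power series. It is
  unique if it exists (\<open>is_coordinator_poly_unique\<close>); existence is part of any claim
  \<^term>\<open>is_coordinator_poly m h\<close>.\<close>

definition is_coordinator_poly :: "nat \<Rightarrow> rat poly \<Rightarrow> bool" where
  "is_coordinator_poly m h \<longleftrightarrow>
     Abs_fps (\<lambda>n. of_nat (growth m n)) = fps_of_poly h / (1 - fps_X) ^ totient m"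

lemma is_coordinator_poly_unique:
  assumes "is_coordinator_poly m h" "is_coordinator_poly m h'"
  shows "h = h'"
proof -
  let ?d = "(1 - fps_X :: rat fps) ^ totient m"
  have nz: "fps_nth ?d 0 \<noteq> 0"
    by (simp add: fps_nth_power_0)
  have "fps_of_poly h / ?d = fps_of_poly h' / ?d"
    using assms by (simp add: is_coordinator_poly_def)
  then have "fps_of_poly h / ?d * ?d = fps_of_poly h' / ?d * ?d"
    by simp
  then have "fps_of_poly h = fps_of_poly h'"
    using nz by (simp add: fps_divide_unit mult.assoc inverse_mult_eq_1)
  then show ?thesis
    by simp
qed

lemma zeta_in_roots_of_unity:
  assumes "m > 0"
  shows "zeta m \<in> roots_of_unity m"
proof -
  have "zeta m ^ m = exp (of_nat m * (2 * of_real pi * \<i> / of_nat m))"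
    unfolding zeta_def by (rule exp_of_nat_mult[symmetric])
  also have "of_nat m * (2 * of_real pi * \<i> / of_nat m) = (2 * of_real pi * \<i> :: complex)"
    using assms by simp
  finally show ?thesis
    by (simp add: roots_of_unity_def)
qed

lemma cyclotomic_integers_generated:
  assumes m: "m \<ge> 2" and z: "z \<in> cyclotomic_integers m"
  shows "\<exists>A. set_mset A \<subseteq> roots_of_unity m \<and> sum_mset A = z"
proof -
  define G where "G = {sum_mset A |A. set_mset A \<subseteq> roots_of_unity m}"
  have G0: "0 \<in> G"
    unfolding G_def by (auto intro!: exI[of _ "{#}"])
  have G_add: "a + b \<in> G" if ab: "a \<in> G" "b \<in> G" for a b
  proof -
    obtain A B where "a = sum_mset A" "set_mset A \<subseteq> roots_of_unity m"
      "b = sum_mset B" "set_mset B \<subseteq> roots_of_unity m"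
      using ab unfolding G_def by blast
    then show ?thesis
      unfolding G_def by (auto intro!: exI[of _ "A + B"])
  qed
  have G_root: "u \<in> G" if "u \<in> roots_of_unity m" for u
    using that unfolding G_def by (auto intro!: exI[of _ "{#u#}"])
  have G_sum: "sum f I \<in> G" if "\<And>i. i \<in> I \<Longrightarrow> f i \<in> G" for f and I :: "complex set"
    using that by (induction I rule: infinite_finite_induct) (auto intro: G0 G_add)
  have G_mult: "u * a \<in> G" if u: "u \<in> roots_of_unity m" and a: "a \<in> G" for u a
  proof -
    obtain A where A: "a = sum_mset A" "set_mset A \<subseteq> roots_of_unity m"
      using a unfolding G_def by blast
    have "u * a = sum_mset (image_mset ((*) u) A)"
      using A(1) sum_mset_distrib_left[of u "\<lambda>x. x" A] by simp
    moreover have "set_mset (image_mset ((*) u) A) \<subseteq> roots_of_unity m"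
      using A u by (auto simp: roots_of_unity_def power_mult_distrib)
    ultimately show ?thesis
      unfolding G_def by blast
  qed
  have one: "1 \<in> roots_of_unity m"
    by (simp add: roots_of_unity_def)
  have fin: "finite (roots_of_unity m)"
    unfolding roots_of_unity_def using m by (intro finite_roots_unity) auto
  have sum0: "\<Sum>(roots_of_unity m) = 0"
    unfolding roots_of_unity_def using m by (intro sum_roots_unity) auto
  have G_neg1: "-1 \<in> G"
  proof -
    have "-1 = \<Sum>(roots_of_unity m - {1})"
      using fin one sum0 by (simp add: sum_diff1)
    then show ?thesis
      using G_sum[of "roots_of_unity m - {1}" "\<lambda>x. x"] G_root by auto
  qed
  have G_nat: "of_nat k * a \<in> G" if "a \<in> G" for k a
    using that by (induction k) (auto simp: algebra_simps intro: G0 G_add)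
  have G_int: "of_int k \<in> G" for k
  proof (cases k)
    case (nonneg n)
    then show ?thesis using G_nat[OF G_root[OF one], of n] by simp
  next
    case (neg n)
    have k: "of_int k = of_nat (Suc n) * (-1 :: complex)"
      unfolding neg by simp
    show ?thesis
      unfolding k by (rule G_nat[OF G_neg1])
  qed
  have zeta: "zeta m \<in> roots_of_unity m"
    using m by (intro zeta_in_roots_of_unity) auto
  have G_poly: "poly (map_poly of_int q) (zeta m) \<in> G" for q :: "int poly"
  proof (induction q)
    case 0
    then show ?case by (simp add: G0)
  next
    case (pCons a q)
    have "poly (map_poly of_int (pCons a q)) (zeta m)
        = of_int a + zeta m * poly (map_poly of_int q) (zeta m)"
      using map_poly_pCons[of "of_int :: int \<Rightarrow> complex" a q] by simp
    then show ?case
      using G_add[OF G_int G_mult[OF zeta pCons.IH]] by simp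
  qed
  obtain q :: "int poly" where "z = poly (map_poly of_int q) (zeta m)"
    using z unfolding cyclotomic_integers_def by auto
  then have "z \<in> G"
    using G_poly by simp
  then show ?thesis
    unfolding G_def by auto
qed

lemma finite_sphere:
  assumes m: "m \<ge> 2"
  shows "finite {z \<in> cyclotomic_integers m. word_length m z = n}"
proof (rule finite_subset)
  have fin: "finite (roots_of_unity m)"
    unfolding roots_of_unity_def using m by (intro finite_roots_unity) auto
  show "finite (sum_list ` {xs. set xs \<subseteq> roots_of_unity m \<and> length xs = n})"
    by (intro finite_imageI finite_lists_length_eq fin)
  show "{z \<in> cyclotomic_integers m. word_length m z = n}
      \<subseteq> sum_list ` {xs. set xs \<subseteq> roots_of_unity m \<and> length xs = n}"
  proof safe
    fix z assume z: "z \<in> cyclotomic_integers m"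
    let ?P = "\<lambda>k. \<exists>A. set_mset A \<subseteq> roots_of_unity m \<and> size A = k \<and> sum_mset A = z"
    have "\<exists>k. ?P k"
      using cyclotomic_integers_generated[OF m z] by blast
    then have "?P (word_length m z)"
      unfolding word_length_def by (rule LeastI_ex)
    then obtain A where A: "set_mset A \<subseteq> roots_of_unity m" "size A = word_length m z"
      "sum_mset A = z"
      by blast
    obtain xs where xs: "mset xs = A"
      using ex_mset by blast
    have "z = sum_list xs"
      using A(3) xs by (metis sum_mset_sum_list)
    moreover have "set xs \<subseteq> roots_of_unity m" "length xs = word_length m z"
      using A xs by auto
    ultimately show "z \<in> sum_list ` {xs. set xs \<subseteq> roots_of_unity m \<and> length xs = word_length m z}"
      by blast
  qed
qed

end

theory Submission
  imports Defs "HOL-Library.Disjoint_Sets"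
begin

text \<open>Write \<open>p = 2m + 1\<close>. The powers of \<open>\<zeta>\<^sub>p\<close> satisfy, by Eisenstein's criterion, no integral linear
  relation besides the multiples of \<open>1 + \<zeta>\<^sub>p + \<dots> + \<zeta>\<^sub>p\<^bsup>p-1\<^esup> = 0\<close>, and the \<open>2p\<close>-th roots of unity are
  \<open>\<plusminus>\<zeta>\<^sub>p\<^bsup>i\<^esup>\<close>. So the ring is \<open>\<int>\<^bsup>p\<^esup>\<close> modulo the diagonal, and the word length of a class is the least
  \<open>\<ell>\<^sub>1\<close>-norm of its elements. As \<open>p\<close> is odd, this minimum is attained exactly at the translate
  whose median is \<open>0\<close>, that is, with at most \<open>m\<close> positive and at most \<open>m\<close> negative entries.
  All vectors have the generating function \<open>((1 + x) / (1 - x))\<^bsup>p\<^esup>\<close>, and those with more than \<open>m\<close> positive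
  entries have \<open>\<Sum>\<^bsub>i>m\<^esub> (p choose i) x\<^bsup>i\<^esup> / (1 - x)\<^bsup>p\<^esup>\<close>, as have those with more than \<open>m\<close> negative entries; these two
  cases exclude each other. Since \<open>(1 + x)\<^bsup>p\<^esup> = \<Sum>\<^bsub>i\<^esub> (p choose i) x\<^bsup>i\<^esup>\<close>, subtracting gives
  \<open>(1 - x) h(x) = \<Sum>\<^bsub>i\<le>m\<^esub> (p choose i) x\<^bsup>i\<^esup> - \<Sum>\<^bsub>i>m\<^esub> (p choose i) x\<^bsup>i\<^esup>\<close>.\<close>

section \<open>Generating functions of weighted sets\<close>

text \<open>An infinite level would count as 0, the value of \<open>card\<close> there; the sum and
  product rules therefore assume \<open>finite_levels\<close>.\<close>

definition weight_gf :: "('a \<Rightarrow> nat) \<Rightarrow> 'a set \<Rightarrow> rat fps" where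
  "weight_gf w S = Abs_fps (\<lambda>n. of_nat (card {x \<in> S. w x = n}))"

definition finite_levels :: "('a \<Rightarrow> nat) \<Rightarrow> 'a set \<Rightarrow> bool" where
  "finite_levels w S \<longleftrightarrow> (\<forall>n. finite {x \<in> S. w x = n})"

lemma finite_levels_subset:
  assumes "finite_levels w T" "S \<subseteq> T"
  shows "finite_levels w S"
  unfolding finite_levels_def
proof
  fix n
  have "{x \<in> S. w x = n} \<subseteq> {x \<in> T. w x = n}"
    using assms(2) by auto
  then show "finite {x \<in> S. w x = n}"
    using assms(1) by (auto simp: finite_levels_def intro: finite_subset)
qed

lemma weight_gf_UN:
  assumes "finite J" "\<And>j. j \<in> J \<Longrightarrow> finite_levels w (S j)" "disjoint_family_on S J"
  shows "weight_gf w (\<Union>j\<in>J. S j) = (\<Sum>j\<in>J. weight_gf w (S j))"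
proof (rule fps_ext)
  fix n
  have "card (\<Union>j\<in>J. {x \<in> S j. w x = n}) = (\<Sum>j\<in>J. card {x \<in> S j. w x = n})"
    using assms by (intro card_UN_disjoint) (fastforce simp: finite_levels_def disjoint_family_on_def)+
  moreover have "(\<Union>j\<in>J. {x \<in> S j. w x = n}) = {x \<in> (\<Union>j\<in>J. S j). w x = n}"
    by auto
  ultimately show "weight_gf w (\<Union>j\<in>J. S j) $ n = (\<Sum>j\<in>J. weight_gf w (S j)) $ n"
    by (simp add: weight_gf_def fps_sum_nth)
qed

lemma weight_gf_Un:
  assumes "finite_levels w S" "finite_levels w T" "S \<inter> T = {}"
  shows "weight_gf w (S \<union> T) = weight_gf w S + weight_gf w T"
proof -
  have "weight_gf w (\<Union>b\<in>UNIV. if b then S else T) = (\<Sum>b\<in>UNIV. weight_gf w (if b then S else T))"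
    using assms by (intro weight_gf_UN) (auto simp: disjoint_family_on_def)
  then show ?thesis
    by (simp add: UNIV_bool Un_commute add.commute)
qed

lemma weight_gf_bij_betw:
  assumes "bij_betw f S T" "\<And>x. x \<in> S \<Longrightarrow> v (f x) = w x"
  shows "weight_gf w S = weight_gf v T"
proof -
  have "card {x \<in> S. w x = n} = card {y \<in> T. v y = n}" for n
  proof (rule bij_betw_same_card)
    show "bij_betw f {x \<in> S. w x = n} {y \<in> T. v y = n}"
      using assms unfolding bij_betw_def by (auto simp: inj_on_def)
  qed
  then show ?thesis by (simp add: weight_gf_def)
qed

text \<open>Splitting by the first weight \<open>i\<close> gives the Cauchy product of the level
  counts; \<open>i \<le> n\<close> keeps the subtraction exact.\<close>

lemma Times_level_eq:
  fixes v :: "'a \<Rightarrow> nat" and w :: "'b \<Rightarrow> nat"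
  shows "{(x, y) \<in> S \<times> T. v x + w y = n} =
   (\<Union>i\<le>n. {x \<in> S. v x = i} \<times> {y \<in> T. w y = n - i})"
  by auto

lemma finite_levels_Times:
  assumes "finite_levels v S" "finite_levels w T"
  shows "finite_levels (\<lambda>(x, y). v x + w y) (S \<times> T)"
proof -
  have "finite {(x, y) \<in> S \<times> T. v x + w y = n}" for n
    unfolding Times_level_eq using assms by (auto simp: finite_levels_def)
  moreover have "{(x, y) \<in> S \<times> T. v x + w y = n} =
    {z \<in> S \<times> T. (\<lambda>(x, y). v x + w y) z = n}" for n
    by auto
  ultimately show ?thesis
    by (simp add: finite_levels_def)
qed

lemma weight_gf_Times:
  assumes "finite_levels v S" "finite_levels w T"
  shows "weight_gf (\<lambda>(x, y). v x + w y) (S \<times> T) = weight_gf v S * weight_gf w T"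
proof (rule fps_ext)
  fix n
  have "card {(x, y) \<in> S \<times> T. v x + w y = n} =
      (\<Sum>i\<le>n. card ({x \<in> S. v x = i} \<times> {y \<in> T. w y = n - i}))"
    unfolding Times_level_eq using assms
    by (intro card_UN_disjoint) (auto simp: finite_levels_def)
  moreover have "{(x, y) \<in> S \<times> T. v x + w y = n} =
    {z \<in> S \<times> T. (\<lambda>(x, y). v x + w y) z = n}"
    by auto
  ultimately show "weight_gf (\<lambda>(x, y). v x + w y) (S \<times> T) $ n = (weight_gf v S * weight_gf w T) $ n"
    by (simp add: weight_gf_def fps_mult_nth card_cartesian_product atLeast0AtMost)
qed

text \<open>Both conclusions share one induction, because the product rule in the insert step needs
  finite levels of the smaller product.\<close>

lemma weight_gf_PiE:
  assumes "finite I" "\<And>i. i \<in> I \<Longrightarrow> finite_levels w (A i)"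
  shows "finite_levels (\<lambda>a. \<Sum>i\<in>I. w (a i)) (Pi\<^sub>E I A) \<and>
    weight_gf (\<lambda>a. \<Sum>i\<in>I. w (a i)) (Pi\<^sub>E I A) = (\<Prod>i\<in>I. weight_gf w (A i))"
  using assms
proof (induction I rule: finite_induct)
  case empty
  \<comment> \<open>The empty product holds one function, of weight 0, so its series is 1.\<close>
  have "{x. x = (\<lambda>i. undefined) \<and> 0 = n} = (if n = 0 then {\<lambda>i. undefined} else {})" for n :: nat
    by auto
  then show ?case
    by (auto simp: weight_gf_def finite_levels_def fps_eq_iff)
next
  case (insert k I)
  let ?f = "\<lambda>(y, g). g(k := y)"
  let ?w = "\<lambda>I a. \<Sum>i\<in>I. w (a i)"
  let ?v = "\<lambda>(y, a). w y + ?w I a"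
  have IH: "finite_levels (?w I) (Pi\<^sub>E I A)"
      "weight_gf (?w I) (Pi\<^sub>E I A) = (\<Prod>i\<in>I. weight_gf w (A i))"
    using insert by auto
  have bij: "bij_betw ?f (A k \<times> Pi\<^sub>E I A) (Pi\<^sub>E (insert k I) A)"
    unfolding bij_betw_def PiE_insert_eq
    using inj_combinator[OF insert.hyps(2), of A] by auto
  have w: "?w (insert k I) (?f z) = ?v z" for z
  proof -
    have "(\<Sum>i\<in>I. w (((snd z)(k := fst z)) i)) = ?w I (snd z)"
      using insert.hyps by (intro sum.cong) auto
    then show ?thesis
      using insert.hyps by (simp add: split_beta)
  qed
  have fin: "finite_levels ?v (A k \<times> Pi\<^sub>E I A)"
    using insert IH by (intro finite_levels_Times) auto
  have "finite_levels (?w (insert k I)) (Pi\<^sub>E (insert k I) A)"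
    unfolding finite_levels_def
  proof
    fix n
    have "{a \<in> Pi\<^sub>E (insert k I) A. ?w (insert k I) a = n} =
        ?f ` {z \<in> A k \<times> Pi\<^sub>E I A. ?v z = n}"
      using bij_betw_imp_surj_on[OF bij, symmetric] w by auto
    then show "finite {a \<in> Pi\<^sub>E (insert k I) A. ?w (insert k I) a = n}"
      using fin by (simp add: finite_levels_def)
  qed
  moreover have "weight_gf ?v (A k \<times> Pi\<^sub>E I A) = weight_gf (?w (insert k I)) (Pi\<^sub>E (insert k I) A)"
    by (rule weight_gf_bij_betw[OF bij]) (rule w)
  moreover have "weight_gf ?v (A k \<times> Pi\<^sub>E I A) = weight_gf w (A k) * weight_gf (?w I) (Pi\<^sub>E I A)"
    using insert IH by (intro weight_gf_Times) auto
  ultimately show ?case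
    using insert.hyps IH by simp
qed

lemma finite_levels_abs: "finite_levels (\<lambda>k::int. nat \<bar>k\<bar>) A"
  unfolding finite_levels_def
proof
  fix n
  show "finite {k \<in> A. nat \<bar>k\<bar> = n}"
    by (rule finite_subset[of _ "{- int n..int n}"]) auto
qed

abbreviation int_gf :: "int set \<Rightarrow> rat fps" where
  "int_gf \<equiv> weight_gf (\<lambda>k. nat \<bar>k\<bar>)"

text \<open>An open half line has one point of each positive norm and a closed one also has 0,
  whence \<open>x/(1-x)\<close> and \<open>1/(1-x)\<close>, here with the denominator multiplied
  out.\<close>

lemma int_gf_half_line:
  assumes "s = 1 \<or> s = -1"
  shows "int_gf {k. s * k > 0} * (1 - fps_X) = fps_X" "int_gf {k. s * k \<le> 0} * (1 - fps_X) = 1"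
    "int_gf UNIV * (1 - fps_X) = 1 + fps_X"
proof -
  have "{k. s * k > 0 \<and> nat \<bar>k\<bar> = n} = (if n = 0 then {} else {s * int n})" for n
    using assms by auto
  then have 1: "int_gf {k. s * k > 0} = Abs_fps (\<lambda>n. if n = 0 then 0 else 1)"
    by (auto simp: weight_gf_def fps_eq_iff)
  have "{k. s * k \<le> 0 \<and> nat \<bar>k\<bar> = n} = {- s * int n}" for n
    using assms by auto
  then have 2: "int_gf {k. s * k \<le> 0} = Abs_fps (\<lambda>n. 1)"
    by (auto simp: weight_gf_def fps_eq_iff)
  show 3: "int_gf {k. s * k > 0} * (1 - fps_X) = fps_X"
    unfolding 1 by (auto simp: fps_eq_iff algebra_simps)
  show 4: "int_gf {k. s * k \<le> 0} * (1 - fps_X) = 1"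
    unfolding 2 by (auto simp: fps_eq_iff algebra_simps)
  have "int_gf ({k. s * k > 0} \<union> {k. s * k \<le> 0}) = int_gf {k. s * k > 0} + int_gf {k. s * k \<le> 0}"
    by (intro weight_gf_Un finite_levels_abs) auto
  moreover have "{k. s * k > 0} \<union> {k. s * k \<le> 0} = UNIV"
    by auto
  ultimately show "int_gf UNIV * (1 - fps_X) = 1 + fps_X"
    using 3 4 by (simp add: distrib_right add.commute)
qed

section \<open>Integer vectors counted by their norm\<close>

abbreviation l1_norm :: "nat \<Rightarrow> (nat \<Rightarrow> int) \<Rightarrow> nat" where
  "l1_norm p a \<equiv> \<Sum>i<p. nat \<bar>a i\<bar>"

text \<open>Extensionality fixes the values outside \<open>{..<p}\<close>, so a vector is just its
  \<open>p\<close> entries and the levels of the norm are finite.\<close>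

abbreviation int_vectors :: "nat \<Rightarrow> (nat \<Rightarrow> int) set" where
  "int_vectors p \<equiv> {..<p} \<rightarrow>\<^sub>E UNIV"

lemma finite_levels_l1_norm: "S \<subseteq> int_vectors p \<Longrightarrow> finite_levels (l1_norm p) S"
  by (rule finite_levels_subset[of _ "int_vectors p"], rule weight_gf_PiE[THEN conjunct1])
    (auto intro: finite_levels_abs)

lemma gf_int_vectors: "weight_gf (l1_norm p) (int_vectors p) * (1 - fps_X) ^ p = (1 + fps_X) ^ p"
  using weight_gf_PiE[of "{..<p}" "\<lambda>k. nat \<bar>k\<bar>" "\<lambda>_. UNIV"] finite_levels_abs
    int_gf_half_line(3)[of 1]
  by (simp flip: power_mult_distrib)

text \<open>The sign \<open>s\<close> covers positive and negative entries at once.\<close>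

lemma gf_many_positive:
  assumes s: "s = 1 \<or> s = -1"
  shows "weight_gf (l1_norm p) {a \<in> int_vectors p. m < card {i. i < p \<and> s * a i > 0}} * (1 - fps_X) ^ p =
    (\<Sum>i\<in>{m<..p}. of_nat (p choose i) * fps_X ^ i)"
proof -
  \<comment> \<open>The vectors are sorted by the exact set \<open>J\<close> of indices with
    \<open>s * a i > 0\<close>; each class \<open>S J\<close> is a product of half lines.\<close>
  define \<J> where "\<J> = {J. J \<subseteq> {..<p} \<and> m < card J}"
  define A where "A J i = (if i \<in> J then {k. s * k > 0} else {k. s * k \<le> 0})" for J and i :: nat
  define S where "S J = Pi\<^sub>E {..<p} (A J)" for J
  have S: "S J \<subseteq> int_vectors p" for J
    unfolding S_def by (intro PiE_mono) auto
  have SJ: "{i. i < p \<and> s * a i > 0} = J" if "a \<in> S J" "J \<subseteq> {..<p}" for a J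
  proof -
    have "s * a i > 0 \<longleftrightarrow> i \<in> J" if "i < p" for i
    proof -
      have "a i \<in> A J i"
        using \<open>a \<in> S J\<close> that by (auto simp: S_def)
      then show ?thesis
        by (auto simp: A_def split: if_splits)
    qed
    then show ?thesis
      using that(2) by auto
  qed
  have fin: "finite \<J>"
    unfolding \<J>_def by (rule finite_subset[of _ "Pow {..<p}"]) auto
  have "{a \<in> int_vectors p. m < card {i. i < p \<and> s * a i > 0}} = (\<Union>J\<in>\<J>. S J)" (is "?L = ?R")
  proof (intro equalityI subsetI)
    fix a assume a: "a \<in> ?L"
    let ?J = "{i. i < p \<and> s * a i > 0}"
    have "a \<in> S ?J"
      using a unfolding S_def A_def by (auto simp: PiE_iff not_less)
    moreover have "?J \<in> \<J>"
      using a by (auto simp: \<J>_def)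
    ultimately show "a \<in> ?R" by blast
  next
    fix a assume "a \<in> ?R"
    then obtain J where "J \<subseteq> {..<p}" "m < card J" "a \<in> S J"
      by (auto simp: \<J>_def)
    then show "a \<in> ?L"
      using SJ S by blast
  qed
  moreover have "disjoint_family_on S \<J>"
    unfolding disjoint_family_on_def
  proof (intro ballI impI)
    fix J K assume JK: "J \<in> \<J>" "K \<in> \<J>" "J \<noteq> K"
    have False if "a \<in> S J" "a \<in> S K" for a
      using SJ[OF that(1)] SJ[OF that(2)] JK by (simp add: \<J>_def)
    then show "S J \<inter> S K = {}"
      by blast
  qed
  ultimately have "weight_gf (l1_norm p) {a \<in> int_vectors p. m < card {i. i < p \<and> s * a i > 0}} =
      (\<Sum>J\<in>\<J>. weight_gf (l1_norm p) (S J))"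
    using weight_gf_UN[OF fin finite_levels_l1_norm[OF S]] by simp
  \<comment> \<open>After clearing denominators each index in \<open>J\<close> contributes
    \<open>x\<close>, each other index 1.\<close>
  moreover have "weight_gf (l1_norm p) (S J) * (1 - fps_X) ^ p = fps_X ^ card J" if "J \<in> \<J>" for J
  proof -
    have "weight_gf (l1_norm p) (S J) = (\<Prod>i<p. int_gf (A J i))"
      unfolding S_def by (intro weight_gf_PiE[THEN conjunct2] finite_levels_abs) auto
    moreover have "(1 - fps_X) ^ p = (\<Prod>i<p. 1 - fps_X :: rat fps)"
      by simp
    ultimately have "weight_gf (l1_norm p) (S J) * (1 - fps_X) ^ p =
        (\<Prod>i<p. int_gf (A J i) * (1 - fps_X))"
      by (simp only: prod.distrib)
    also have "\<dots> = (\<Prod>i<p. if i \<in> J then fps_X else 1)"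
      by (intro prod.cong) (auto simp: A_def int_gf_half_line[OF s])
    also have "\<dots> = fps_X ^ card ({..<p} \<inter> J)"
      by (simp add: prod.If_cases)
    also have "{..<p} \<inter> J = J"
      using that by (auto simp: \<J>_def)
    finally show ?thesis .
  qed
  ultimately have "weight_gf (l1_norm p) {a \<in> int_vectors p. m < card {i. i < p \<and> s * a i > 0}} * (1 - fps_X) ^ p =
      (\<Sum>J\<in>\<J>. fps_X ^ card J)"
    by (simp add: sum_distrib_right)
  also have "\<dots> = (\<Sum>i\<in>{m<..p}. \<Sum>J\<in>{J \<in> \<J>. card J = i}. fps_X ^ card J)"
  proof (rule sum.group[symmetric])
    show "card ` \<J> \<subseteq> {m<..p}"
      by (auto simp: \<J>_def dest: card_mono[rotated])
  qed (use fin in auto)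
  also have "\<dots> = (\<Sum>i\<in>{m<..p}. of_nat (p choose i) * fps_X ^ i)"
  proof (rule sum.cong[OF refl])
    fix i assume i: "i \<in> {m<..p}"
    have "card {J \<in> \<J>. card J = i} = p choose i"
      using n_subsets[of "{..<p}" i] i
      by (auto simp: \<J>_def intro!: arg_cong[of _ _ card] elim!: trans[rotated])
    then show "(\<Sum>J\<in>{J \<in> \<J>. card J = i}. fps_X ^ card J) = (of_nat (p choose i) * fps_X ^ i :: rat fps)"
      by simp
  qed
  finally show ?thesis .
qed

text \<open>For odd \<open>p\<close> the two bounds say that the median of the entries is 0.\<close>

definition balanced :: "nat \<Rightarrow> (nat \<Rightarrow> int) set" where
  "balanced p = {a \<in> int_vectors p. 2 * card {i. i < p \<and> a i > 0} < p \<and> 2 * card {i. i < p \<and> a i < 0} < p}"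

lemma gf_balanced:
  assumes p: "p = 2 * m + 1"
  shows "weight_gf (l1_norm p) (balanced p) * (1 - fps_X) ^ p =
    (\<Sum>i\<le>m. of_nat (p choose i) * fps_X ^ i) - (\<Sum>i\<in>{m<..p}. of_nat (p choose i) * fps_X ^ i)"
proof -
  \<comment> \<open>The factors \<open>1 *\<close> and \<open>-1 *\<close> match the form of
    \<open>gf_many_positive\<close> for the two signs.\<close>
  define P N where "P = {a \<in> int_vectors p. m < card {i. i < p \<and> 1 * a i > 0}}"
    and "N = {a \<in> int_vectors p. m < card {i. i < p \<and> -1 * a i > 0}}"
  have sub: "P \<subseteq> int_vectors p" "N \<subseteq> int_vectors p" "balanced p \<subseteq> int_vectors p"
    by (auto simp: P_def N_def balanced_def)
  \<comment> \<open>A common element would need at least \<open>2 * m + 2 > p\<close>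
    indices.\<close>
  have "P \<inter> N = {}"
  proof -
    have False if "a \<in> P" "a \<in> N" for a
    proof -
      have "card ({i. i < p \<and> 1 * a i > 0} \<union> {i. i < p \<and> -1 * a i > 0}) \<le> card {..<p}"
        by (rule card_mono) auto
      also have "card ({i. i < p \<and> 1 * a i > 0} \<union> {i. i < p \<and> -1 * a i > 0}) =
        card {i. i < p \<and> 1 * a i > 0} + card {i. i < p \<and> -1 * a i > 0}"
        by (rule card_Un_disjoint) auto
      finally show False
        using that p by (simp add: P_def N_def)
    qed
    then show ?thesis by blast
  qed
  moreover have "balanced p = int_vectors p - (P \<union> N)"
  proof -
    have "2 * k < p \<longleftrightarrow> \<not> m < k" for k
      using p by linarith
    then show ?thesis
      by (simp add: P_def N_def balanced_def set_eq_iff) blast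
  qed
  then have "balanced p \<inter> (P \<union> N) = {}" "balanced p \<union> (P \<union> N) = int_vectors p"
    using sub by blast+
  ultimately have "weight_gf (l1_norm p) (int_vectors p) =
      weight_gf (l1_norm p) (balanced p) + (weight_gf (l1_norm p) P + weight_gf (l1_norm p) N)"
    using weight_gf_Un[of "l1_norm p" "balanced p" "P \<union> N"] weight_gf_Un[of "l1_norm p" P N] sub
    by (simp add: finite_levels_l1_norm)
  then have "weight_gf (l1_norm p) (balanced p) * (1 - fps_X) ^ p =
     weight_gf (l1_norm p) (int_vectors p) * (1 - fps_X) ^ p - weight_gf (l1_norm p) P * (1 - fps_X) ^ p
     - weight_gf (l1_norm p) N * (1 - fps_X) ^ p"
    by (simp add: algebra_simps)
  also have "weight_gf (l1_norm p) P * (1 - fps_X) ^ p = (\<Sum>i\<in>{m<..p}. of_nat (p choose i) * fps_X ^ i)"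
    unfolding P_def by (rule gf_many_positive) simp
  also have "weight_gf (l1_norm p) N * (1 - fps_X) ^ p = (\<Sum>i\<in>{m<..p}. of_nat (p choose i) * fps_X ^ i)"
    unfolding N_def by (rule gf_many_positive) simp
  also note gf_int_vectors
  also have "(1 + fps_X :: rat fps) ^ p = (\<Sum>i\<le>p. of_nat (p choose i) * fps_X ^ i)"
    using binomial_ring[of "fps_X :: rat fps" 1 p] by (simp add: add.commute)
  also have "{..p} = {..m} \<union> {m<..p}"
    using p by auto
  also have "(\<Sum>i\<in>{..m} \<union> {m<..p}. of_nat (p choose i) * fps_X ^ i :: rat fps) =
      (\<Sum>i\<le>m. of_nat (p choose i) * fps_X ^ i) + (\<Sum>i\<in>{m<..p}. of_nat (p choose i) * fps_X ^ i)"
    by (rule sum.union_disjoint) auto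
  finally show ?thesis
    by simp
qed

section \<open>Coefficients of the claimed polynomial\<close>

text \<open>The factor \<open>1 - x\<close> takes differences of consecutive coefficients. Those of
  \<open>h\<close> are partial binomial sums, rising up to \<open>m\<close> and mirrored afterwards,
  so the differences are binomial coefficients, negated past the middle by symmetry.\<close>

lemma coordinator_poly_times:
  fixes h :: "rat poly"
  assumes p: "p = 2 * m + 1" and m: "m \<ge> 1"
  defines "h \<equiv> (\<Sum>k = 0..(p - 3) div 2.
        (monom 1 k + monom 1 (p - 1 - k)) * (\<Sum>j = 0..k. of_nat (p choose j)))
     + monom 1 ((p - 1) div 2) * (\<Sum>j = 0..(p - 1) div 2. of_nat (p choose j))"
  shows "fps_of_poly h * (1 - fps_X) =
    (\<Sum>i\<le>m. of_nat (p choose i) * fps_X ^ i) - (\<Sum>i\<in>{m<..p}. of_nat (p choose i) * fps_X ^ i)"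
    (is "_ = ?R")
proof (rule fps_ext)
  define B where "B k = (\<Sum>j\<le>k. p choose j)" for k
  have B_poly: "(\<Sum>j = 0..k. of_nat (p choose j)) = ([:of_nat (B k):] :: rat poly)" for k
    by (simp add: B_def atLeast0AtMost flip: of_nat_poly of_nat_sum)
  have h: "h = (\<Sum>k<m. monom (of_nat (B k)) k + monom (of_nat (B k)) (2 * m - k))
      + monom (of_nat (B m)) m"
  proof -
    have "{0..(p - 3) div 2} = {..<m}" "(p - 1) div 2 = m"
      using p m by auto
    then show ?thesis
      unfolding h_def B_poly using p by (simp add: algebra_simps smult_monom)
  qed
  have coeff_h: "coeff h n = (if n \<le> m then of_nat (B n) else if n \<le> 2 * m then of_nat (B (2 * m - n)) else 0)" for n
  proof -
    \<comment> \<open>The guard \<open>n \<le> 2 * m\<close> is needed because truncated subtraction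
      would otherwise select \<open>k = 0\<close>.\<close>
    have "(\<Sum>k<m. if 2 * m - k = n then of_nat (B k) else 0 :: rat) =
        (\<Sum>k<m. if k = 2 * m - n then (if n \<le> 2 * m then of_nat (B k) else 0) else 0)"
      by (intro sum.cong) auto
    then show ?thesis
      unfolding h by (auto simp: coeff_sum sum.distrib sum.delta)
  qed
  have B_Suc: "B (Suc k) = B k + (p choose Suc k)" for k
    by (simp add: B_def)
  have B0: "B 0 = 1"
    by (simp add: B_def)
  fix n
  have R: "?R $ n = (if n \<le> m then of_nat (p choose n) else if n \<le> p then - of_nat (p choose n) else 0)"
  proof -
    have "(\<Sum>i\<in>K. of_nat (p choose i) * fps_X ^ i) $ n = (if n \<in> K then of_nat (p choose n) else 0 :: rat)"
      if "finite K" for K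
    proof -
      have "(\<Sum>i\<in>K. of_nat (p choose i) * fps_X ^ i) $ n =
        (\<Sum>i\<in>K. if i = n then of_nat (p choose i) else 0 :: rat)"
        unfolding fps_sum_nth
        by (intro sum.cong) (auto simp: fps_of_nat[symmetric] simp del: fps_of_nat)
      then show ?thesis using that by (simp add: sum.delta)
    qed
    then show ?thesis by auto
  qed
  have L: "(fps_of_poly h * (1 - fps_X)) $ n = coeff h n - (if n = 0 then 0 else coeff h (n - 1))"
    by (simp add: algebra_simps)
  show "(fps_of_poly h * (1 - fps_X)) $ n = ?R $ n"
  proof (cases n)
    case 0
    then show ?thesis unfolding L R by (simp add: coeff_h B0)
  next
    case (Suc k)
    \<comment> \<open>Rising half, falling half, the step \<open>n = p\<close> from
      \<open>B 0\<close> down to 0, and beyond the degree.\<close>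
    consider "k < m" | "m \<le> k" "k < 2 * m" | "k = 2 * m" | "k > 2 * m" by linarith
    then show ?thesis
    proof cases
      case 2
      have "B (2 * m - k) = B (2 * m - Suc k) + (p choose (2 * m - k))"
        using 2 B_Suc[of "2 * m - Suc k"] by (simp add: Suc_diff_Suc)
      moreover have "p choose (2 * m - k) = p choose Suc k"
        using binomial_symmetric[of "Suc k" p] 2 p by simp
      \<comment> \<open>At \<open>k = m\<close> the coefficient is read from the rising branch of
        \<open>coeff_h\<close>; both branches agree there.\<close>
      moreover have "B k = B (2 * m - k)" if "k = m" using that by simp
      ultimately show ?thesis
        unfolding L R using Suc 2 p by (auto simp: coeff_h)
    qed (unfold L R, use Suc p m in \<open>auto simp: coeff_h B_Suc B0\<close>)
  qed
qed

section \<open>Linear relations between roots of unity of prime order\<close>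

abbreviation ipoly :: "int poly \<Rightarrow> complex \<Rightarrow> complex" where
  "ipoly f x \<equiv> poly (map_poly of_int f) x"

lemma ipoly_add: "ipoly (f + g) x = ipoly f x + ipoly g x"
proof -
  have "map_poly of_int (f + g) = map_poly of_int f + (map_poly of_int g :: complex poly)"
    by (intro poly_eqI) (simp add: coeff_map_poly)
  then show ?thesis by simp
qed

lemma ipoly_mult: "ipoly (f * g) x = ipoly f x * ipoly g x"
proof -
  have "map_poly of_int (f * g) = map_poly of_int f * (map_poly of_int g :: complex poly)"
    by (intro poly_eqI) (simp add: coeff_map_poly coeff_mult)
  then show ?thesis by simp
qed

lemma ipoly_pCons: "ipoly (pCons c f) x = of_int c + x * ipoly f x"
  using map_poly_pCons[of "of_int :: int \<Rightarrow> complex" c f] by simp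

lemma ipoly_sum: "ipoly (\<Sum>i\<in>I. f i) x = (\<Sum>i\<in>I. ipoly (f i) x)"
  by (induction I rule: infinite_finite_induct) (auto simp: ipoly_add)

lemma ipoly_monom: "ipoly (monom c n) x = of_int c * x ^ n"
  by (simp add: map_poly_monom poly_monom)

lemma ipoly_pcompose: "ipoly (pcompose f g) x = ipoly f (ipoly g x)"
  by (induction f) (auto simp: pcompose_pCons ipoly_add ipoly_mult ipoly_pCons)

lemma ipoly_primitive_part: "f \<noteq> 0 \<Longrightarrow> ipoly f x = 0 \<Longrightarrow> ipoly (primitive_part f) x = 0"
proof -
  assume f: "f \<noteq> 0" "ipoly f x = 0"
  have "f = [:content f:] * primitive_part f"
    by simp
  then have "0 = of_int (content f) * ipoly (primitive_part f) x"
    using f ipoly_mult[of "[:content f:]" "primitive_part f" x] by (simp add: ipoly_pCons)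
  then show ?thesis using f by simp
qed

section \<open>Eisenstein's criterion\<close>

text \<open>Let \<open>i\<close> be the first index where \<open>\<pi>\<close> does not divide
  \<open>q\<close>. In coefficient \<open>i\<close> of \<open>q * s\<close> every term but
  \<open>coeff q i * coeff s 0\<close> is divisible by \<open>\<pi>\<close>, so \<open>i\<close> is
  at least the degree of \<open>q * s\<close>, and \<open>q\<close> already has full degree.\<close>

lemma eisenstein_cofactor_const:
  fixes q s :: "'a :: {factorial_semiring, comm_ring_1} poly"
  assumes "prime \<pi>" "\<pi> dvd coeff q 0" "\<not> \<pi> dvd coeff s 0"
    and "\<not> \<pi> dvd lead_coeff (q * s)"
    and "\<And>i. i < degree (q * s) \<Longrightarrow> \<pi> dvd coeff (q * s) i"
  shows "degree s = 0"
proof -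
  have nz: "q \<noteq> 0" "s \<noteq> 0"
    using assms(4) by auto
  have ex: "\<not> \<pi> dvd coeff q (degree q)"
    using assms(4) by (auto simp: lead_coeff_mult)
  define i where "i = (LEAST i. \<not> \<pi> dvd coeff q i)"
  have i: "\<not> \<pi> dvd coeff q i"
    unfolding i_def by (rule LeastI) (rule ex)
  have less: "\<pi> dvd coeff q j" if "j < i" for j
    using not_less_Least[of j] that unfolding i_def by blast
  have "coeff (q * s) i = (\<Sum>j<i. coeff q j * coeff s (i - j)) + coeff q i * coeff s 0"
    by (simp add: coeff_mult lessThan_Suc_atMost[symmetric])
  moreover have "\<pi> dvd (\<Sum>j<i. coeff q j * coeff s (i - j))"
    by (intro dvd_sum dvd_mult2 less) auto
  moreover have "\<not> \<pi> dvd coeff q i * coeff s 0"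
    using assms(1,3) i by (simp add: prime_dvd_mult_iff)
  ultimately have "\<not> \<pi> dvd coeff (q * s) i"
    by (simp add: dvd_add_right_iff)
  then have "degree (q * s) \<le> i"
    using assms(5) by (meson not_le)
  also have "i \<le> degree q"
    unfolding i_def by (rule Least_le) (rule ex)
  finally show ?thesis
    using nz by (simp add: degree_mult_eq)
qed

text \<open>A nonzero polynomial of least degree vanishing at \<open>x\<close>, made primitive,
  divides \<open>E\<close> over the integers. Its constant coefficient or that of its cofactor is
  prime to \<open>\<pi>\<close>, which makes one of the two factors constant; both cases are
  absurd.\<close>

lemma eisenstein_minimal_degree:
  fixes E f :: "int poly"
  assumes E: "lead_coeff E = 1" "ipoly E x = 0"
    and \<pi>: "prime \<pi>" "\<And>i. i < degree E \<Longrightarrow> \<pi> dvd coeff E i" "\<not> \<pi>\<^sup>2 dvd coeff E 0"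
    and f: "ipoly f x = 0" "degree f < degree E"
  shows "f = 0"
proof (rule ccontr)
  assume "f \<noteq> 0"
  define d where "d = (LEAST d. \<exists>q. q \<noteq> 0 \<and> ipoly q x = 0 \<and> degree q = d)"
  have "\<exists>q. q \<noteq> 0 \<and> ipoly q x = 0 \<and> degree q = d"
    unfolding d_def by (rule LeastI[of _ "degree f"]) (use f \<open>f \<noteq> 0\<close> in blast)
  then obtain q0 where q0: "q0 \<noteq> 0" "ipoly q0 x = 0" "degree q0 = d"
    by blast
  have min: "d \<le> degree q" if "q \<noteq> 0" "ipoly q x = 0" for q
    unfolding d_def by (rule Least_le) (use that in blast)
  define q where "q = primitive_part q0"
  have q: "q \<noteq> 0" "ipoly q x = 0" "degree q = d" "content q = 1"
    using q0 by (simp_all add: q_def ipoly_primitive_part)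
  have "d < degree E"
    using min[OF \<open>f \<noteq> 0\<close> f(1)] f(2) by simp
  \<comment> \<open>Integer division needs the scaling by \<open>a\<close>; the remainder also
    vanishes at \<open>x\<close>, so it is 0 by minimality of \<open>d\<close>.\<close>
  obtain a s where as: "a \<noteq> 0" "smult a E = q * s + pseudo_mod E q"
    using pseudo_mod(1)[OF q(1)] by blast
  have "ipoly (smult a E) x = ipoly ([:a:] * E) x"
    by simp
  then have "ipoly (smult a E) x = 0"
    using E(2) unfolding ipoly_mult by simp
  then have "ipoly (pseudo_mod E q) x = 0"
    unfolding as(2) ipoly_add ipoly_mult using q(2) by simp
  then have "pseudo_mod E q = 0"
    using pseudo_mod(2)[OF q(1), of E] min[of "pseudo_mod E q"] q(3) by linarith
  then have aE: "smult a E = q * s"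
    using as(2) by simp
  \<comment> \<open>Gauss's lemma: contents multiply, so with \<open>E\<close> and \<open>q\<close>
    primitive the factor \<open>a\<close> sits entirely in \<open>s\<close> and cancels.\<close>
  have "content E = 1"
  proof -
    have "content E dvd 1"
      using content_dvd_coeff[of E "degree E"] E(1) by simp
    then show ?thesis
      using trans[OF normalize_content[of E, symmetric] is_unit_normalize] by simp
  qed
  then have "content s = normalize a"
    using arg_cong[OF aE, of content] q(4) by (simp add: content_mult)
  then have "[:a:] dvd s"
    unfolding const_poly_dvd_iff_dvd_content by simp
  then obtain s' where s': "s = smult a s'"
    by (auto elim!: dvdE)
  have "smult a E = smult a (q * s')"
    unfolding aE s' by (rule mult_smult_right)
  then have Eqs: "E = q * s'"
    by (rule smult_cancel[OF as(1)])
  have pos: "degree q > 0"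
  proof (rule ccontr)
    assume "\<not> degree q > 0"
    then obtain c where "q = [:c:]"
      using degree_eq_zeroE[of q] by blast
    then show False using q by (simp add: ipoly_pCons)
  qed
  have E0: "coeff E 0 = coeff q 0 * coeff s' 0"
    by (simp add: Eqs coeff_mult)
  have dvd: "\<pi> dvd coeff q 0 * coeff s' 0"
    using \<pi>(2)[of 0] \<open>d < degree E\<close> by (simp flip: E0)
  have not_both: "\<not> (\<pi> dvd coeff q 0 \<and> \<pi> dvd coeff s' 0)"
    using \<pi>(3) mult_dvd_mono[of \<pi> "coeff q 0" \<pi> "coeff s' 0"]
    by (auto simp: E0 power2_eq_square)
  have lead: "\<not> \<pi> dvd 1"
    using \<pi>(1) not_prime_unit by blast
  have "s' \<noteq> 0" using Eqs E(1) by auto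
  then have deg: "degree E = degree q + degree s'"
    using q(1) Eqs by (simp add: degree_mult_eq)
  from dvd \<pi>(1) consider "\<pi> dvd coeff q 0" | "\<pi> dvd coeff s' 0"
    by (auto simp: prime_dvd_mult_iff)
  then show False
  proof cases
    case 1
    then have "degree s' = 0"
    proof (rule eisenstein_cofactor_const[OF \<pi>(1)])
      show "\<not> \<pi> dvd coeff s' 0" using 1 not_both by blast
    qed (use E(1) \<pi>(2) lead Eqs in simp_all)
    then show False using deg \<open>d < degree E\<close> q(3) by simp
  next
    case 2
    have "E = s' * q"
      using Eqs by (simp only: mult.commute)
    from 2 have "degree q = 0"
    proof (rule eisenstein_cofactor_const[OF \<pi>(1)])
      show "\<not> \<pi> dvd coeff q 0" using 2 not_both by blast
    qed (use E(1) \<pi>(2) lead \<open>E = s' * q\<close> in simp_all)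
    then show False using pos by simp
  qed
qed

section \<open>Integral independence of the powers of zeta\<close>

lemma zeta_power: "zeta n ^ k = cis (2 * pi * real k / real n)"
  by (simp add: zeta_def cis_conv_exp exp_of_nat_mult[symmetric] algebra_simps)

lemma zeta_neq_1:
  assumes "n > 1"
  shows "zeta n \<noteq> 1"
proof
  assume "zeta n = 1"
  then have "cis (2 * pi * real 1 / real n) = cis (2 * pi * real 0 / real n)"
    using zeta_power[of n 1] by simp
  moreover have "inj_on (\<lambda>k. cis (2 * pi * real k / real n)) {..<n}"
    using bij_betw_roots_unity[of n] assms by (simp add: bij_betw_def)
  ultimately have "(1::nat) = 0"
    using assms by (elim inj_onD) auto
  then show False by simp
qed

lemma sum_zeta_powers:
  assumes "n > 1"
  shows "(\<Sum>i<n. zeta n ^ i) = 0"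
proof -
  have "(\<Sum>i<n. zeta n ^ i) = (\<Sum>i<n. cis (2 * pi * real i / real n))"
    by (simp add: zeta_power)
  also have "\<dots> = \<Sum>{z. z ^ n = 1}"
    using assms by (intro sum.reindex_bij_betw bij_betw_roots_unity) auto
  also have "\<dots> = 0"
    using assms by (rule sum_roots_unity)
  finally show ?thesis .
qed

text \<open>The shift to \<open>y = zeta p - 1\<close> makes Eisenstein's criterion applicable at
  \<open>p\<close>: below the leading coefficient stand binomial coefficients divisible by
  \<open>p\<close>, and the constant one is \<open>p\<close> itself.\<close>

lemma zeta_prime_minimal_degree:
  assumes p: "prime p" and f: "ipoly f (zeta p) = 0" "degree f < p - 1"
  shows "f = 0"
proof -
  \<comment> \<open>\<open>E\<close> is \<open>((1 + y)\<^bsup>p\<^esup> - 1) / y\<close>, the cyclotomic polynomial at \<open>y + 1\<close>\<close>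
  define E :: "int poly" where "E = (\<Sum>i<p. monom (int (p choose Suc i)) i)"
  define y where "y = zeta p - 1"
  have p1: "p > 1"
    using p by (rule prime_gt_1_nat)
  have coeff_E: "coeff E i = (if i < p then int (p choose Suc i) else 0)" for i
    by (simp add: E_def coeff_sum sum.delta)
  have deg: "degree E = p - 1"
  proof (rule antisym)
    show "degree E \<le> p - 1"
      by (intro degree_le) (auto simp: coeff_E)
    show "p - 1 \<le> degree E"
      using p1 by (intro le_degree) (simp add: coeff_E)
  qed
  \<comment> \<open>By the binomial theorem this is \<open>(y + 1) ^ p - 1 = 0\<close>, and
    \<open>y\<close> is nonzero.\<close>
  have "y * ipoly E y = (\<Sum>i<p. of_nat (p choose Suc i) * y ^ Suc i)"
    by (simp add: E_def ipoly_sum ipoly_monom sum_distrib_left algebra_simps)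
  also have "\<dots> = (\<Sum>i<Suc p. of_nat (p choose i) * y ^ i) - 1"
    by (subst sum.lessThan_Suc_shift) simp
  also have "(\<Sum>i<Suc p. of_nat (p choose i) * y ^ i) = (y + 1) ^ p"
    by (simp add: binomial_ring lessThan_Suc_atMost)
  also have "(y + 1) ^ p = 1"
    using zeta_in_roots_of_unity[of p] p1 by (simp add: y_def roots_of_unity_def)
  finally have "ipoly E y = 0"
    using zeta_neq_1[OF p1] by (simp add: y_def)
  moreover have "lead_coeff E = 1"
    using p1 by (simp add: deg coeff_E)
  moreover have "int p dvd coeff E i" if "i < degree E" for i
  proof -
    have "p dvd (p choose Suc i)"
      using that p by (intro dvd_choose_prime) (auto simp: deg)
    then show ?thesis
      by (simp add: coeff_E)
  qed
  moreover have "\<not> (int p)\<^sup>2 dvd coeff E 0"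
  proof
    assume "(int p)\<^sup>2 dvd coeff E 0"
    then have "int p * int p dvd int p * 1"
      using p1 by (simp add: coeff_E power2_eq_square)
    then show False
      using p1 by (subst (asm) dvd_times_left_cancel_iff) auto
  qed
  moreover have "ipoly (pcompose f [:1, 1:]) y = 0"
    using f(1) by (simp add: ipoly_pcompose ipoly_pCons y_def)
  moreover have "degree (pcompose f [:1, 1:]) < degree E"
    using f(2) by (simp add: deg degree_pcompose)
  ultimately have "pcompose f [:1, 1:] = 0"
    using p by (intro eisenstein_minimal_degree[of E y "int p"]) auto
  then show ?thesis
    by (simp add: pcompose_eq_0_iff)
qed

text \<open>Subtracting \<open>c (p - 1)\<close> times the vanishing sum of all powers removes the
  top power; the remaining polynomial has degree below \<open>p - 1\<close> and must be 0.\<close>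

lemma zeta_prime_linear_relation:
  assumes p: "prime p" and c: "(\<Sum>i<p. of_int (c i) * zeta p ^ i) = 0" and i: "i < p"
  shows "c i = c (p - 1)"
proof -
  define f where "f = (\<Sum>i<p-1. monom (c i - c (p - 1)) i)"
  have p1: "p > 1"
    using p by (rule prime_gt_1_nat)
  have coeff_f: "coeff f i = (if i < p - 1 then c i - c (p - 1) else 0)" for i
    by (simp add: f_def coeff_sum sum.delta)
  have "ipoly f (zeta p) = (\<Sum>i<Suc (p-1). of_int (c i - c (p - 1)) * zeta p ^ i)"
    by (simp add: f_def ipoly_sum ipoly_monom)
  also have "\<dots> = (\<Sum>i<p. of_int (c i) * zeta p ^ i) - of_int (c (p - 1)) * (\<Sum>i<p. zeta p ^ i)"
    using p1 by (simp add: left_diff_distrib sum_subtractf sum_distrib_left)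
  also have "\<dots> = 0"
    using c sum_zeta_powers[OF p1] by simp
  finally have "f = 0"
  proof (cases "f = 0")
    case False
    assume "ipoly f (zeta p) = 0"
    moreover have "degree f < p - 1"
      using False coeff_f[of "degree f"] by (metis leading_coeff_0_iff)
    ultimately show ?thesis
      using zeta_prime_minimal_degree[OF p] by blast
  qed
  moreover have "i < p - 1 \<or> i = p - 1"
    using i by linarith
  ultimately show ?thesis
    using coeff_f[of i] by auto
qed

section \<open>Word length as a norm\<close>

abbreviation zsum :: "nat \<Rightarrow> (nat \<Rightarrow> int) \<Rightarrow> complex" where
  "zsum p a \<equiv> \<Sum>i<p. of_int (a i) * zeta p ^ i"

text \<open>Here \<open>w ^ p\<close> is 1 or -1, and as \<open>p\<close> is odd a sign on
  \<open>w\<close> turns it into a \<open>p\<close>-th root of unity.\<close>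

lemma roots_of_unity_double:
  assumes "odd p"
  shows "w \<in> roots_of_unity (2 * p) \<longleftrightarrow> (\<exists>i<p. \<exists>s\<in>{1, -1 :: int}. w = of_int s * zeta p ^ i)"
proof
  assume "w \<in> roots_of_unity (2 * p)"
  then have "(w ^ p)\<^sup>2 = 1"
    by (simp add: roots_of_unity_def flip: power_mult) (simp add: mult.commute)
  then have "w ^ p = 1 \<or> w ^ p = -1"
    by (simp add: power2_eq_1_iff)
  then obtain s :: int where s: "s \<in> {1, -1}" "(of_int s * w) ^ p = 1"
  proof
    assume "w ^ p = 1"
    then show ?thesis using that[of 1] by simp
  next
    assume "w ^ p = -1"
    then show ?thesis using that[of "-1"] assms by simp
  qed
  have "of_int s * w \<in> (\<lambda>k. cis (2 * pi * real k / real p)) ` {..<p}"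
    using bij_betw_roots_unity[of p] assms s(2) by (auto simp: bij_betw_def odd_pos)
  then obtain i where i: "i < p" "of_int s * w = zeta p ^ i"
    by (auto simp: zeta_power)
  moreover have "of_int s * (of_int s * w) = w"
    using s(1) by auto
  then have "w = of_int s * zeta p ^ i"
    unfolding i(2) by (rule sym)
  ultimately show "\<exists>i<p. \<exists>s\<in>{1, -1 :: int}. w = of_int s * zeta p ^ i"
    using s(1) by blast
next
  have "zeta p ^ p = 1"
    using zeta_in_roots_of_unity[of p] assms by (simp add: roots_of_unity_def odd_pos)
  then have 1: "(zeta p ^ i) ^ (2 * p) = 1" for i
    by (metis (no_types) mult.commute power_mult power_one)
  assume "\<exists>i<p. \<exists>s\<in>{1, -1 :: int}. w = of_int s * zeta p ^ i"
  then obtain i and s :: int where "s \<in> {1, -1}" "w = of_int s * zeta p ^ i"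
    by blast
  moreover from this have "(of_int s) ^ (2 * p) = (1 :: complex)"
    by (auto simp: power_mult)
  ultimately show "w \<in> roots_of_unity (2 * p)"
    using 1 by (simp add: roots_of_unity_def power_mult_distrib)
qed

text \<open>Each root changes one entry by 1 or -1. Only an inequality holds, because opposite
  summands cancel.\<close>

lemma zsum_of_mset:
  assumes "odd p" "set_mset A \<subseteq> roots_of_unity (2 * p)"
  shows "\<exists>a\<in>int_vectors p. zsum p a = sum_mset A \<and> l1_norm p a \<le> size A"
  using assms(2)
proof (induction A)
  case empty
  have "(\<lambda>i\<in>{..<p}. 0) \<in> int_vectors p" "zsum p (\<lambda>i\<in>{..<p}. 0) = 0" "l1_norm p (\<lambda>i\<in>{..<p}. 0) = 0"
    by simp_all
  then show ?case by (intro bexI[of _ "\<lambda>i\<in>{..<p}. 0"]) simp_all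
next
  case (add w A)
  then obtain a where a: "a \<in> int_vectors p" "zsum p a = sum_mset A" "l1_norm p a \<le> size A"
    by auto
  obtain k and s :: int where k: "k < p" "s \<in> {1, -1}" "w = of_int s * zeta p ^ k"
  proof -
    have "w \<in> roots_of_unity (2 * p)"
      using add.prems by simp
    then show ?thesis
      unfolding roots_of_unity_double[OF assms(1)] using that by blast
  qed
  define b where "b = a(k := a k + s)"
  have "b \<in> int_vectors p"
    using a(1) k(1) by (auto simp: b_def PiE_iff extensional_def)
  moreover have "zsum p b = zsum p a + w"
  proof -
    have "zsum p b = (\<Sum>i<p. of_int (a i) * zeta p ^ i + (if i = k then w else 0))"
      using k by (intro sum.cong) (auto simp: b_def algebra_simps)
    then show ?thesis
      using k(1) by (simp add: sum.distrib sum.delta)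
  qed
  moreover have "l1_norm p b \<le> l1_norm p a + 1"
  proof -
    have "l1_norm p b \<le> (\<Sum>i<p. nat \<bar>a i\<bar> + (if i = k then 1 else 0))"
      using k(2) by (intro sum_mono) (auto simp: b_def)
    then show ?thesis
      using k(1) by (simp add: sum.distrib sum.delta)
  qed
  ultimately show ?case
    using a by (intro bexI[of _ b]) auto
qed

lemma mset_of_zsum:
  assumes "odd p"
  shows "\<exists>A. set_mset A \<subseteq> roots_of_unity (2 * p) \<and> size A = l1_norm p a \<and> sum_mset A = zsum p a"
proof -
  have "\<exists>A. set_mset A \<subseteq> roots_of_unity (2 * p) \<and> size A = (\<Sum>i<n. nat \<bar>a i\<bar>) \<and>
      sum_mset A = (\<Sum>i<n. of_int (a i) * zeta p ^ i)" if "n \<le> p" for n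
    using that
  proof (induction n)
    case 0
    then show ?case by (intro exI[of _ "{#}"]) simp
  next
    case (Suc n)
    then obtain A where A: "set_mset A \<subseteq> roots_of_unity (2 * p)" "size A = (\<Sum>i<n. nat \<bar>a i\<bar>)"
      "sum_mset A = (\<Sum>i<n. of_int (a i) * zeta p ^ i)"
      by auto
    \<comment> \<open>For \<open>a n = 0\<close> the choice of sign is immaterial: no copy of
      \<open>w\<close> is added.\<close>
    define w where "w = of_int (if a n < 0 then -1 else 1) * zeta p ^ n"
    have "w \<in> roots_of_unity (2 * p)"
      unfolding roots_of_unity_double[OF assms] using Suc.prems
      by (auto simp: w_def intro!: exI[of _ n])
    moreover have "of_nat (nat \<bar>a n\<bar>) * w = of_int (a n) * zeta p ^ n"
      by (auto simp: w_def)
    ultimately show ?case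
      using A by (intro exI[of _ "A + replicate_mset (nat \<bar>a n\<bar>) w"])
        (auto simp: sum_mset_replicate_mset)
  qed
  then show ?thesis by blast
qed

text \<open>Generation by roots of unity gives one inclusion, the square of
  \<open>zeta (2 * p)\<close> being \<open>zeta p\<close> the other.\<close>

lemma cyclotomic_integers_double:
  assumes "odd p"
  shows "cyclotomic_integers (2 * p) = zsum p ` int_vectors p"
proof (intro equalityI subsetI)
  fix z assume "z \<in> cyclotomic_integers (2 * p)"
  moreover have "2 * p \<ge> 2"
    using assms by (auto elim: oddE)
  ultimately obtain A where "set_mset A \<subseteq> roots_of_unity (2 * p)" "sum_mset A = z"
    using cyclotomic_integers_generated by blast
  then obtain a where "a \<in> int_vectors p" "zsum p a = z"
    using zsum_of_mset[OF assms] by metis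
  then show "z \<in> zsum p ` int_vectors p"
    by blast
next
  fix z assume "z \<in> zsum p ` int_vectors p"
  then obtain a where a: "z = zsum p a" by blast
  have "zeta (2 * p) ^ (2 * i) = zeta p ^ i" for i
    by (simp add: zeta_power mult.assoc)
  then have "z = ipoly (\<Sum>i<p. monom (a i) (2 * i)) (zeta (2 * p))"
    by (simp add: a ipoly_sum ipoly_monom)
  then show "z \<in> cyclotomic_integers (2 * p)"
    by (auto simp: cyclotomic_integers_def)
qed

section \<open>Minimal norm modulo the diagonal\<close>

lemma int_l1_norm: "int (l1_norm p a) = (\<Sum>i<p. \<bar>a i\<bar>)"
  by simp

lemma sum_if_card:
  fixes p :: nat
  shows "(\<Sum>i<p. if P i then c else 0 :: int) = c * int (card {i. i < p \<and> P i})"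
proof -
  have "(\<Sum>i<p. if P i then c else 0) = (\<Sum>i\<in>{i \<in> {..<p}. P i}. c)"
    by (rule sum.inter_filter[symmetric]) simp
  then show ?thesis
    by simp
qed

text \<open>Only entries of sign opposite to \<open>t\<close> can lose, each at most
  \<open>\<bar>t\<bar>\<close>; all others gain exactly \<open>\<bar>t\<bar>\<close>. The losers are
  fewer than half.\<close>

lemma l1_shift_balanced:
  assumes a: "a \<in> balanced p" and b: "\<And>i. i < p \<Longrightarrow> b i = a i + t" and t: "t \<noteq> 0"
  shows "l1_norm p a < l1_norm p b"
proof -
  define s :: int where "s = sgn t"
  have s: "s = 1 \<or> s = -1"
    using t by (auto simp: s_def sgn_if)
  define K where "K = card {i. i < p \<and> s * a i < 0}"
  have K: "2 * K < p"
    using s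
  proof
    assume "s = 1"
    with a show ?thesis by (simp add: K_def balanced_def)
  next
    assume "s = -1"
    with a show ?thesis by (simp add: K_def balanced_def)
  qed
  have "\<bar>a i\<bar> + \<bar>t\<bar> - (if s * a i < 0 then 2 * \<bar>t\<bar> else 0) \<le> \<bar>a i + t\<bar>" for i
  proof (cases "t > 0")
    case True
    then have "s = 1" by (simp add: s_def)
    then show ?thesis using True by auto
  next
    case False
    then have "s = -1" using t by (simp add: s_def)
    then show ?thesis using False by auto
  qed
  then have "(\<Sum>i<p. \<bar>a i\<bar> + \<bar>t\<bar> - (if s * a i < 0 then 2 * \<bar>t\<bar> else 0)) \<le> (\<Sum>i<p. \<bar>b i\<bar>)"
    using b by (intro sum_mono) auto
  then have "int (l1_norm p a) + int p * \<bar>t\<bar> - 2 * \<bar>t\<bar> * int K \<le> int (l1_norm p b)"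
    unfolding int_l1_norm by (simp add: sum.distrib sum_subtractf sum_if_card K_def)
  moreover have "0 < \<bar>t\<bar> * (int p - 2 * int K)"
    using t K by (intro mult_pos_pos) auto
  ultimately have "int (l1_norm p a) < int (l1_norm p b)"
    by (simp add: algebra_simps)
  then show ?thesis by (simp only: of_nat_less_iff)
qed

text \<open>More than half of the entries have one strict sign \<open>s\<close>. Subtracting
  \<open>s\<close> everywhere shortens these by 1, lengthens the rest by 1 and keeps the value,
  since the powers of \<open>zeta p\<close> sum to 0.\<close>

lemma unbalanced_shorter:
  assumes p: "odd p" "p > 1" and a: "a \<in> int_vectors p" "a \<notin> balanced p"
  shows "\<exists>b\<in>int_vectors p. zsum p b = zsum p a \<and> l1_norm p b < l1_norm p a"
proof -
  have "\<exists>s :: int. (s = 1 \<or> s = -1) \<and> \<not> 2 * card {i. i < p \<and> s * a i > 0} < p"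
  proof (cases "2 * card {i. i < p \<and> a i > 0} < p")
    case True
    then have "\<not> 2 * card {i. i < p \<and> a i < 0} < p"
      using a by (simp add: balanced_def)
    then show ?thesis by (intro exI[of _ "-1"]) simp
  next
    case False
    then show ?thesis by (intro exI[of _ 1]) simp
  qed
  then obtain s :: int where s: "s = 1 \<or> s = -1" "\<not> 2 * card {i. i < p \<and> s * a i > 0} < p"
    by blast
  define K where "K = card {i. i < p \<and> s * a i > 0}"
  \<comment> \<open>Oddness of \<open>p\<close> excludes a tie.\<close>
  have K: "2 * K > p"
    using s(2) p(1) unfolding K_def[symmetric] by (metis even_mult_iff even_numeral linorder_neqE_nat)
  define b where "b = (\<lambda>i\<in>{..<p}. a i - s)"
  have "b \<in> int_vectors p"
    by (simp add: b_def)
  moreover have "zsum p b = zsum p a"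
  proof -
    have "zsum p b = (\<Sum>i<p. of_int (a i) * zeta p ^ i - of_int s * zeta p ^ i)"
      by (intro sum.cong) (auto simp: b_def algebra_simps)
    also have "\<dots> = zsum p a - of_int s * (\<Sum>i<p. zeta p ^ i)"
      by (simp add: sum_subtractf sum_distrib_left)
    finally show ?thesis
      using sum_zeta_powers[OF p(2)] by simp
  qed
  moreover have "int (l1_norm p b) = int (l1_norm p a) + int p - 2 * int K"
  proof -
    have "(\<Sum>i<p. \<bar>b i\<bar>) = (\<Sum>i<p. \<bar>a i\<bar> + 1 - (if s * a i > 0 then 2 else 0))"
      using s(1) by (intro sum.cong) (auto simp: b_def)
    then show ?thesis
      unfolding int_l1_norm by (simp add: sum.distrib sum_subtractf sum_if_card K_def)
  qed
  then have "l1_norm p b < l1_norm p a"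
    using K by linarith
  ultimately show ?thesis by blast
qed

text \<open>Two representations of one number differ by a constant vector, and a nonzero shift of a
  balanced vector is longer. This yields both the word length and uniqueness.\<close>

lemma zsum_eq_balanced:
  assumes p: "prime p" and a: "a \<in> balanced p" and b: "b \<in> int_vectors p" and eq: "zsum p a = zsum p b"
  shows "b = a \<or> l1_norm p a < l1_norm p b"
proof -
  define t where "t = b (p - 1) - a (p - 1)"
  have "(\<Sum>i<p. of_int (b i - a i) * zeta p ^ i) = 0"
    using eq by (simp add: left_diff_distrib sum_subtractf)
  then have "b i - a i = t" if "i < p" for i
    using zeta_prime_linear_relation[OF p, of "\<lambda>i. b i - a i", OF _ that] by (simp add: t_def)
  then have bt: "b i = a i + t" if "i < p" for i
    using that by (simp add: algebra_simps eq_diff_eq)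
  show ?thesis
  proof (cases "t = 0")
    case True
    have "b = a"
      using a b bt True by (intro PiE_ext[of _ "{..<p}" "\<lambda>_. UNIV"]) (auto simp: balanced_def)
    then show ?thesis ..
  next
    case False
    then show ?thesis
      using l1_shift_balanced[OF a bt] by blast
  qed
qed

lemma word_length_balanced:
  assumes p: "prime p" "odd p" and a: "a \<in> balanced p"
  shows "word_length (2 * p) (zsum p a) = l1_norm p a"
  unfolding word_length_def
proof (rule Least_equality)
  show "\<exists>A. set_mset A \<subseteq> roots_of_unity (2 * p) \<and> size A = l1_norm p a \<and> sum_mset A = zsum p a"
    by (rule mset_of_zsum[OF p(2)])
next
  fix n assume "\<exists>A. set_mset A \<subseteq> roots_of_unity (2 * p) \<and> size A = n \<and> sum_mset A = zsum p a"
  then obtain b where b: "b \<in> int_vectors p" "zsum p a = zsum p b" "l1_norm p b \<le> n"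
    using zsum_of_mset[OF p(2)] by metis
  show "l1_norm p a \<le> n"
    using zsum_eq_balanced[OF p(1) a b(1,2)] b(3) by auto
qed

text \<open>Two distinct balanced representatives would each be strictly shorter than the other; a
  shortest representative exists and must be balanced.\<close>

lemma bij_betw_zsum_balanced:
  assumes p: "prime p" "odd p"
  shows "bij_betw (zsum p) (balanced p) (cyclotomic_integers (2 * p))"
proof -
  have sub: "balanced p \<subseteq> int_vectors p"
    by (auto simp: balanced_def)
  have "inj_on (zsum p) (balanced p)"
  proof (rule inj_onI)
    fix a b assume ab: "a \<in> balanced p" "b \<in> balanced p" "zsum p a = zsum p b"
    then have "b = a \<or> l1_norm p a < l1_norm p b" "a = b \<or> l1_norm p b < l1_norm p a"
      using zsum_eq_balanced[OF p(1)] sub ab(3)[symmetric] by blast+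
    then show "a = b" by auto
  qed
  moreover have "z \<in> zsum p ` balanced p" if "z \<in> zsum p ` int_vectors p" for z
  proof -
    from that obtain a0 where "a0 \<in> int_vectors p \<and> zsum p a0 = z"
      by blast
    then obtain a where a: "a \<in> int_vectors p \<and> zsum p a = z"
      and min: "\<And>b. b \<in> int_vectors p \<and> zsum p b = z \<Longrightarrow> l1_norm p a \<le> l1_norm p b"
      using ex_has_least_nat[of "\<lambda>a. a \<in> int_vectors p \<and> zsum p a = z" a0 "l1_norm p"] by blast
    have "a \<in> balanced p"
    proof (rule ccontr)
      assume "a \<notin> balanced p"
      then obtain b where "b \<in> int_vectors p" "zsum p b = zsum p a" "l1_norm p b < l1_norm p a"
        using unbalanced_shorter[OF p(2) prime_gt_1_nat[OF p(1)], of a] a by blast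
      then show False
        using min[of b] a by simp
    qed
    then show ?thesis using a by blast
  qed
  ultimately show ?thesis
    unfolding bij_betw_def cyclotomic_integers_double[OF p(2)] using sub by blast
qed

theorem theorem5p4:
  fixes p :: nat
  assumes "prime p" and "odd p"
  shows "is_coordinator_poly (2 * p)
    ((\<Sum>k = 0..(p - 3) div 2.
        (monom 1 k + monom 1 (p - 1 - k)) * (\<Sum>j = 0..k. of_nat (p choose j)))
     + monom 1 ((p - 1) div 2) * (\<Sum>j = 0..(p - 1) div 2. of_nat (p choose j)))"
    (is "is_coordinator_poly _ ?h")
proof -
  let ?G = "Abs_fps (\<lambda>n. of_nat (growth (2 * p) n)) :: rat fps"
  obtain m where m: "p = 2 * m + 1"
    using assms(2) by (elim oddE)
  have "m \<ge> 1"
    using prime_gt_1_nat[OF assms(1)] m by simp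
  have "?G = weight_gf (word_length (2 * p)) (cyclotomic_integers (2 * p))"
    by (simp add: growth_def weight_gf_def)
  also have "\<dots> = weight_gf (l1_norm p) (balanced p)"
    by (rule weight_gf_bij_betw[OF bij_betw_zsum_balanced[OF assms], symmetric])
      (rule word_length_balanced[OF assms])
  finally have "?G * (1 - fps_X) ^ p = fps_of_poly ?h * (1 - fps_X)"
    using gf_balanced[OF m] coordinator_poly_times[OF m \<open>m \<ge> 1\<close>] by simp
  \<comment> \<open>The vectors have \<open>p\<close> entries but the rank is \<open>p - 1\<close>;
    the extra factor cancels against the one beside \<open>h\<close>.\<close>
  moreover have "(1 - fps_X :: rat fps) ^ p = (1 - fps_X) ^ (p - 1) * (1 - fps_X)"
    using m by simp
  moreover have nz: "(1 - fps_X :: rat fps) $ 0 \<noteq> 0"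
    by simp
  then have "(1 - fps_X :: rat fps) \<noteq> 0"
    by (rule contrapos_nn) simp
  ultimately have "?G * (1 - fps_X) ^ (p - 1) = fps_of_poly ?h"
    by (simp flip: mult.assoc)
  moreover have "(1 - fps_X :: rat fps) ^ (p - 1) \<noteq> 0"
    using \<open>1 - fps_X \<noteq> 0\<close> by (rule power_not_zero)
  ultimately have "?G = fps_of_poly ?h / (1 - fps_X) ^ (p - 1)"
    by (metis nonzero_mult_div_cancel_right)
  moreover have "totient (2 * p) = p - 1"
    using assms by (simp add: totient_double totient_prime)
  ultimately show ?thesis
    by (simp add: is_coordinator_poly_def)
qed

end
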